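(* For all positive integers $k,n$, $$\sum_{i=0}^{n}M_{2i+1}^{(k)}=\frac{2^kM_{n+1}^{(2k)}-n-1}{M_k} .$$
   Context: The Mersenne numbers $\{M_n\}_{n\ge 0}$ are defined by $M_0=0$, $M_1=1$, $M_{n+2}=3M_{n+1}-2M_n$, i.e. $M_n=2^n-1$. For a positive integer $k$, the higher order Mersenne numbers are $M_n^{(k)}=M_{kn}/M_k$ for $n=0,1,2,\dots$ (so $M_n^{(2k)}=M_{2kn}/M_{2k}$). *)

theory Defs
  imports Complex_Main
begin

fun mersenne :: "nat \<Rightarrow> int" where
  "mersenne 0 = 0"
| "mersenne (Suc 0) = 1"
| "mersenne (Suc (Suc n)) = 3 * mersenne (Suc n) - 2 * mersenne n"

lemma mersenne_closed_form: "mersenne n = 2 ^ n - 1"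
  by (induction n rule: mersenne.induct) (simp_all add: algebra_simps)

text \<open>The first argument is the order \<open>k\<close> (the superscript), the second the index \<open>n\<close>.
  The quotient is taken in the rationals; for \<open>k = 0\<close> it is the junk value \<open>0\<close>.\<close>

definition higher_mersenne :: "nat \<Rightarrow> nat \<Rightarrow> rat" where
  "higher_mersenne k n = of_int (mersenne (k * n)) / of_int (mersenne k)"

end

theory Submission imports Defs
begin

text \<open>With \<open>q = 2 ^ k\<close>, the summand is
  \<open>(q * (q\<^sup>2) ^ i - 1) / (q - 1)\<close>, where \<open>q - 1\<close> is the Mersenne
  number of index \<open>k\<close>. The powers form a geometric series of ratio
  \<open>q\<^sup>2 = 2 ^ (2 * k)\<close>, and by \<open>higher_mersenne_eq\<close> its closed form
  is itself a higher order Mersenne number, of order \<open>2 * k\<close>.\<close>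

lemma higher_mersenne_eq:
  "higher_mersenne k n = ((2 ^ k) ^ n - 1) / (2 ^ k - 1)"
  by (simp add: higher_mersenne_def mersenne_closed_form power_mult)

theorem theorem2p19:
  fixes k n :: nat
  assumes "k > 0" and "n > 0"
  shows "(\<Sum>i = 0..n. higher_mersenne k (2 * i + 1)) =
    (2 ^ k * higher_mersenne (2 * k) (n + 1) - of_nat n - 1) / of_int (mersenne k)"
proof -
  define q :: rat where "q = 2 ^ k"
  have q2: "q\<^sup>2 = 2 ^ (2 * k)"
    by (simp add: q_def power_mult [symmetric] mult.commute)
  \<comment> \<open>Positivity of \<open>k\<close> keeps the ratio away from 1, as the geometric sum
    formula requires.\<close>
  have "(2 :: rat) ^ (2 * k) > 1"
    using assms(1) by (intro one_less_power) simp_all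
  then have "q\<^sup>2 \<noteq> 1"
    unfolding q2 by simp
  have geometric: "(\<Sum>i = 0..n. (q\<^sup>2) ^ i) = higher_mersenne (2 * k) (n + 1)"
    using geometric_sum [OF \<open>q\<^sup>2 \<noteq> 1\<close>, of "n + 1"]
    by (simp only: higher_mersenne_eq q2 atLeast0AtMost lessThan_Suc_atMost Suc_eq_plus1 [symmetric])
  have "(\<Sum>i = 0..n. higher_mersenne k (2 * i + 1)) = (\<Sum>i = 0..n. q * (q\<^sup>2) ^ i - 1) / (q - 1)"
    by (simp add: higher_mersenne_eq q_def [symmetric] sum_divide_distrib power_mult)
  \<comment> \<open>The range \<open>0..n\<close> has \<open>n + 1\<close> terms, so the subtracted
    ones total \<open>n + 1\<close>.\<close>
  also have "(\<Sum>i = 0..n. q * (q\<^sup>2) ^ i - 1) = q * higher_mersenne (2 * k) (n + 1) - of_nat n - 1"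
    by (simp add: sum_subtractf sum_distrib_left [symmetric] geometric del: One_nat_def)
  finally show ?thesis
    by (simp add: q_def mersenne_closed_form)
qed

end
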